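(* Let $\mathcal{H}$ be a complex Hilbert space, $T_2,T_3\in\mathcal{L}(\mathcal{H})$ and $q\in(0,1]$. Then $$w_q^2\left(\begin{bmatrix} O & T_2 \\ {} T_3 & O \end{bmatrix}\right)\ge\frac{q}{2}\max\{w_q(T_2T_3+T_3T_2),\,w_q(T_2T_3-T_3T_2)\}.$$
   Context: $\mathcal{L}(\mathcal{H})$ is the algebra of bounded linear operators on the complex Hilbert space $\mathcal{H}$. For $q\in\mathbb{C}$ with $|q|\le 1$, the $q$-numerical radius of a bounded operator $T$ on a Hilbert space $\mathcal{K}$ is $w_q(T)=\sup\{|\langle Tx,y\rangle| : x,y\in\mathcal{K},\ \|x\|=\|y\|=1,\ \langle x,y\rangle=q\}$; $w_q^2(T)$ means $(w_q(T))^2$. When $|q|<1$ it is understood that $\dim\mathcal{H}\ge 2$, so that this supremum is over a nonempty set. A $2\times2$ operator matrix with entries in $\mathcal{L}(\mathcal{H})$ acts on the Hilbert space direct sum $\mathcal{H}\oplus\mathcal{H}$; $O$ is the zero operator. *)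

theory Defs
  imports "HOL-Analysis.Analysis"
begin

class complex_inner_space = real_normed_vector +
  fixes scaleC :: "complex \<Rightarrow> 'a \<Rightarrow> 'a"  (infixr "*\<^sub>C" 75)
    and cinner :: "'a \<Rightarrow> 'a \<Rightarrow> complex"
  assumes scaleC_add_right: "c *\<^sub>C (x + y) = c *\<^sub>C x + c *\<^sub>C y"
    and scaleC_add_left: "(c + d) *\<^sub>C x = c *\<^sub>C x + d *\<^sub>C x"
    and scaleC_scaleC: "c *\<^sub>C d *\<^sub>C x = (c * d) *\<^sub>C x"
    and scaleC_one: "1 *\<^sub>C x = x"
    and scaleR_scaleC: "r *\<^sub>R x = complex_of_real r *\<^sub>C x"
    and cinner_add_left: "cinner (x + y) z = cinner x z + cinner y z"
    and cinner_scaleC_left: "cinner (c *\<^sub>C x) y = c * cinner x y"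
    and cinner_commute: "cinner x y = cnj (cinner y x)"
    and cinner_self: "cinner x x = complex_of_real ((norm x)\<^sup>2)"

class complex_hilbert_space = complex_inner_space + complete_space

interpretation complex_vector:
  vector_space "scaleC :: complex \<Rightarrow> 'a \<Rightarrow> 'a :: complex_inner_space"
  by unfold_locales (rule scaleC_add_right scaleC_add_left scaleC_scaleC scaleC_one)+

text \<open>The product type, with the componentwise operations and the library's Euclidean
  norm, is the Hilbert space direct sum.\<close>

instantiation prod :: (complex_inner_space, complex_inner_space) complex_inner_space
begin

definition scaleC_prod :: "complex \<Rightarrow> 'a \<times> 'b \<Rightarrow> 'a \<times> 'b"
  where "scaleC_prod c z = (c *\<^sub>C fst z, c *\<^sub>C snd z)"

definition cinner_prod :: "'a \<times> 'b \<Rightarrow> 'a \<times> 'b \<Rightarrow> complex"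
  where "cinner_prod z w = cinner (fst z) (fst w) + cinner (snd z) (snd w)"

instance
proof
  fix c d :: complex and r :: real and x y z :: "'a \<times> 'b"
  show "c *\<^sub>C (x + y) = c *\<^sub>C x + c *\<^sub>C y"
    by (simp add: scaleC_prod_def scaleC_add_right)
  show "(c + d) *\<^sub>C x = c *\<^sub>C x + d *\<^sub>C x"
    by (simp add: scaleC_prod_def scaleC_add_left)
  show "c *\<^sub>C d *\<^sub>C x = (c * d) *\<^sub>C x"
    by (simp add: scaleC_prod_def scaleC_scaleC)
  show "1 *\<^sub>C x = x"
    by (simp add: scaleC_prod_def scaleC_one)
  show "r *\<^sub>R x = complex_of_real r *\<^sub>C x"
    by (simp add: scaleC_prod_def scaleR_prod_def scaleR_scaleC)
  show "cinner (x + y) z = cinner x z + cinner y z"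
    by (simp add: cinner_prod_def cinner_add_left)
  show "cinner (c *\<^sub>C x) y = c * cinner x y"
    by (simp add: cinner_prod_def scaleC_prod_def cinner_scaleC_left distrib_left)
  show "cinner x y = cnj (cinner y x)"
    by (simp add: cinner_prod_def cinner_commute[symmetric])
  show "cinner x x = complex_of_real ((norm x)\<^sup>2)"
    by (simp add: cinner_prod_def cinner_self norm_prod_def del: of_real_power)
qed

end

instance prod :: (complex_hilbert_space, complex_hilbert_space) complex_hilbert_space ..

definition bounded_clinear ::
    "('a::complex_inner_space \<Rightarrow> 'b::complex_inner_space) \<Rightarrow> bool"
  where "bounded_clinear T \<longleftrightarrow> bounded_linear T \<and> (\<forall>c x. T (c *\<^sub>C x) = c *\<^sub>C T x)"

text \<open>On the reals \<open>Sup {}\<close> is unspecified. The supremum below is one of nonnegative numbers,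
  so it is taken to be \<open>0\<close> if there are no admissible pairs, as happens on the zero space
  (and, for \<open>cmod q < 1\<close>, in dimension one).\<close>

definition q_numerical_radius ::
    "complex \<Rightarrow> ('a::complex_inner_space \<Rightarrow> 'a) \<Rightarrow> real"
  where "q_numerical_radius q T =
    (let V = {cmod (cinner (T x) y) | x y. norm x = 1 \<and> norm y = 1 \<and> cinner x y = q}
     in if V = {} then 0 else Sup V)"

definition block_operator ::
    "('a \<Rightarrow> 'a) \<Rightarrow> ('a \<Rightarrow> 'a) \<Rightarrow> ('a \<Rightarrow> 'a) \<Rightarrow> ('a \<Rightarrow> 'a) \<Rightarrow>
      'a \<times> 'a \<Rightarrow> 'a \<times> ('a::complex_inner_space)"
  where "block_operator A B C D = (\<lambda>(x, y). (A x + B y, C x + D y))"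

end

(*
  Write s = sqrt (1 - q^2) and let |z \<and> u| = sqrt (|z|^2 |u|^2 - |<z, u>|^2), which is a seminorm in u.
  If q |<A u, u>| + s |A u \<and> u| \<le> q M |u|^2 for all u, then z = (M - A) u satisfies
  q Re <z, u> \<ge> s |z \<and> u|.  For z = (M^2 - A^2) x this applies both to A with u = (M + A) x and to
  -A with v = (M - A) x.  As u + v = 2 M x, adding up gives q Re <z, x> \<ge> s |z \<and> x|, whence
  Re <z, y> \<ge> 0 for all unit vectors y with <x, y> = q.  Rotating A by a phase yields the power
  inequality q w_q (A^2) \<le> w_q (A)^2.  The square of the off-diagonal operator matrix is the
  diagonal one with entries T2 T3 and T3 T2, so both products have q-numerical radius
  at most w_q^2 / q.
*)
theory Submission
  imports Defs
begin

section \<open>Complex inner products\<close>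

lemma cinner_add_right: "cinner x (y + z) = cinner x y + cinner x z"
  by (metis cinner_commute cinner_add_left complex_cnj_add)

lemma cinner_scaleC_right: "cinner x (c *\<^sub>C y) = cnj c * cinner x y"
  by (metis cinner_commute cinner_scaleC_left complex_cnj_mult)

lemma cinner_scaleR_left: "cinner (r *\<^sub>R x) y = of_real r * cinner x y"
  by (simp add: scaleR_scaleC cinner_scaleC_left)

lemma cinner_scaleR_right: "cinner x (r *\<^sub>R y) = of_real r * cinner x y"
  by (simp add: scaleR_scaleC cinner_scaleC_right)

lemma cinner_minus_left: "cinner (- x) y = - cinner x y"
  using cinner_scaleR_left[of "-1" x y] by simp

lemma cinner_minus_right: "cinner x (- y) = - cinner x y"
  using cinner_scaleR_right[of x "-1" y] by simp

lemma cinner_diff_left: "cinner (x - y) z = cinner x z - cinner y z"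
  using cinner_add_left[of x "- y" z] by (simp add: cinner_minus_left)

lemma cinner_diff_right: "cinner x (y - z) = cinner x y - cinner x z"
  using cinner_add_right[of x y "- z"] by (simp add: cinner_minus_right)

lemma cinner_zero_left [simp]: "cinner 0 x = 0"
  using cinner_scaleR_left[of 0 0 x] by simp

lemma cinner_zero_right [simp]: "cinner x 0 = 0"
  using cinner_scaleR_right[of x 0 0] by simp

lemma cnj_cinner: "cnj (cinner x y) = cinner y x"
  by (rule cinner_commute[symmetric])

lemma cmod_cinner_commute: "cmod (cinner x y) = cmod (cinner y x)"
  by (metis cnj_cinner complex_mod_cnj)

lemmas cinner_simps = cinner_add_left cinner_add_right cinner_diff_left cinner_diff_right
  cinner_scaleC_left cinner_scaleC_right cinner_scaleR_left cinner_scaleR_right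
  cinner_minus_left cinner_minus_right

lemma mult_cnj_eq: "z * cnj z = (complex_of_real (cmod z))\<^sup>2"
  by (metis complex_norm_square of_real_power)

lemma norm_scaleC: "norm (c *\<^sub>C x) = cmod c * norm x"
proof -
  have "complex_of_real ((norm (c *\<^sub>C x))\<^sup>2) = of_real ((cmod c * norm x)\<^sup>2)"
    unfolding cinner_self[symmetric] cinner_scaleC_left cinner_scaleC_right
    by (simp add: cinner_self power_mult_distrib mult_ac mult_cnj_eq)
  then have "(norm (c *\<^sub>C x))\<^sup>2 = (cmod c * norm x)\<^sup>2"
    by (simp only: of_real_eq_iff)
  then show ?thesis by (simp add: power2_eq_iff_nonneg)
qed

lemma norm_sq_eq_Re_cinner: "(norm x)\<^sup>2 = Re (cinner x x)"
  by (simp add: cinner_self del: of_real_power)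

lemma norm_add_sq: "(norm (x + y))\<^sup>2 = (norm x)\<^sup>2 + (norm y)\<^sup>2 + 2 * Re (cinner x y)"
proof -
  have "Re (cinner y x) = Re (cinner x y)"
    by (subst cinner_commute) simp
  then show ?thesis
    by (simp add: norm_sq_eq_Re_cinner cinner_simps)
qed

text \<open>Pythagoras: since \<open>cinner\<close> is linear in its first argument, the subtracted
  vector is the orthogonal projection of \<open>z\<close> onto the complex line through
  \<open>u\<close>.\<close>

lemma norm_sq_diff_proj:
  assumes "norm u = 1"
  shows "(norm (z - cinner z u *\<^sub>C u))\<^sup>2 = (norm z)\<^sup>2 - (cmod (cinner z u))\<^sup>2"
proof -
  let ?p = "cinner z u *\<^sub>C u"
  have "cinner z (- ?p) = - of_real ((cmod (cinner z u))\<^sup>2)"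
    by (simp add: cinner_simps mult.commute mult_cnj_eq)
  then have "Re (cinner z (- ?p)) = - (cmod (cinner z u))\<^sup>2"
    by (simp only: Re_complex_of_real uminus_complex.sel)
  then show ?thesis
    using norm_add_sq[of z "- ?p"] assms by (simp add: norm_scaleC)
qed

text \<open>For the unit vector \<open>u\<close> in the direction of \<open>y\<close>, the squared
  distance from \<open>x\<close> to the line through \<open>u\<close> is nonnegative.\<close>

lemma cauchy_schwarz: "cmod (cinner x y) \<le> norm x * norm y"
proof (cases "y = 0")
  case False
  define u where "u = y /\<^sub>R norm y"
  have u: "norm u = 1" and y: "y = norm y *\<^sub>R u"
    using False by (simp_all add: u_def)
  have "0 \<le> (norm x)\<^sup>2 - (cmod (cinner x u))\<^sup>2"
    unfolding norm_sq_diff_proj[OF u, of x, symmetric] by simp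
  then have "(cmod (cinner x u))\<^sup>2 \<le> (norm x)\<^sup>2"
    by simp
  then have "cmod (cinner x u) \<le> norm x"
    by (rule power2_le_imp_le) simp
  then have "norm y * cmod (cinner x u) \<le> norm y * norm x"
    by (rule mult_left_mono) simp
  moreover have "cinner x y = of_real (norm y) * cinner x u"
    using cinner_scaleR_right[of x "norm y" u] by (simp only: y[symmetric])
  ultimately show ?thesis
    by (simp add: norm_mult mult.commute)
qed simp

section \<open>The norm of an exterior product\<close>

text \<open>The radicand is the Gram determinant of \<open>z\<close> and \<open>u\<close>,
  nonnegative by Cauchy-Schwarz. For a unit vector \<open>u\<close> the value is the distance from
  \<open>z\<close> to the complex line through \<open>u\<close>.\<close>

definition wedge_norm :: "'a::complex_inner_space \<Rightarrow> 'a \<Rightarrow> real"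
  where "wedge_norm z u = sqrt ((norm z)\<^sup>2 * (norm u)\<^sup>2 - (cmod (cinner z u))\<^sup>2)"

lemma wedge_norm_commute: "wedge_norm z u = wedge_norm u z"
  by (simp add: wedge_norm_def cmod_cinner_commute[of z u] mult.commute)

lemma wedge_norm_scaleR: "wedge_norm z (r *\<^sub>R u) = \<bar>r\<bar> * wedge_norm z u"
proof -
  have "(norm z)\<^sup>2 * (norm (r *\<^sub>R u))\<^sup>2 - (cmod (cinner z (r *\<^sub>R u)))\<^sup>2
      = r\<^sup>2 * ((norm z)\<^sup>2 * (norm u)\<^sup>2 - (cmod (cinner z u))\<^sup>2)"
    by (simp add: cinner_scaleR_right norm_mult power_mult_distrib algebra_simps)
  then show ?thesis
    by (simp add: wedge_norm_def real_sqrt_mult)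
qed

lemma wedge_norm_unit:
  assumes "norm u = 1"
  shows "wedge_norm z u = norm (z - cinner z u *\<^sub>C u)"
  using norm_sq_diff_proj[OF assms, of z] assms by (simp add: wedge_norm_def real_sqrt_unique)

text \<open>With \<open>e\<close> the direction of \<open>z\<close>, the value is
  \<open>norm z\<close> times the norm of the component orthogonal to \<open>e\<close>. Taking that
  component is additive, so the triangle inequality of the norm carries over.\<close>

lemma wedge_norm_triangle: "wedge_norm z (u + v) \<le> wedge_norm z u + wedge_norm z v"
proof (cases "z = 0")
  case True
  then show ?thesis by (simp add: wedge_norm_def)
next
  case False
  define e where "e = z /\<^sub>R norm z"
  have e: "norm e = 1" and z: "z = norm z *\<^sub>R e"
    using False by (simp_all add: e_def)
  have wedge: "wedge_norm z w = norm z * norm (w - cinner w e *\<^sub>C e)" for w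
  proof -
    have "wedge_norm z w = wedge_norm w (norm z *\<^sub>R e)"
      using z wedge_norm_commute by metis
    then show ?thesis
      by (simp add: wedge_norm_scaleR wedge_norm_unit[OF e])
  qed
  have eq: "u + v - cinner (u + v) e *\<^sub>C e = (u - cinner u e *\<^sub>C e) + (v - cinner v e *\<^sub>C e)"
    by (simp add: cinner_add_left scaleC_add_left)
  have "norm (u + v - cinner (u + v) e *\<^sub>C e)
      \<le> norm (u - cinner u e *\<^sub>C e) + norm (v - cinner v e *\<^sub>C e)"
    unfolding eq by (rule norm_triangle_ineq)
  then show ?thesis
    unfolding wedge by (simp flip: distrib_left add: mult_left_mono)
qed

text \<open>The witness is the normalized component \<open>p\<close> of \<open>z\<close> orthogonal
  to \<open>u\<close>. If \<open>p = 0\<close>, both sides vanish and any unit vector orthogonal to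
  \<open>u\<close> serves; \<open>orth\<close> supplies one.\<close>

lemma wedge_norm_attained:
  assumes orth: "\<exists>g. norm g = 1 \<and> cinner u g = 0" and u: "norm u = 1"
  shows "\<exists>g. norm g = 1 \<and> cinner u g = 0 \<and> cinner z g = of_real (wedge_norm z u)"
proof -
  define p where "p = z - cinner z u *\<^sub>C u"
  have uu: "cinner u u = 1" using u by (simp add: cinner_self)
  have wedge: "wedge_norm z u = norm p" by (simp add: p_def wedge_norm_unit[OF u])
  have up: "cinner u p = 0"
    by (simp add: p_def cinner_simps uu cnj_cinner)
  have zg: "cinner z g = cinner p g" if "cinner u g = 0" for g
    using that by (simp add: p_def cinner_simps)
  show ?thesis
  proof (cases "p = 0")
    case True
    then show ?thesis using orth wedge zg by auto
  next
    case False
    have "cinner u (p /\<^sub>R norm p) = 0" by (simp add: cinner_simps up)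
    moreover have "cinner p (p /\<^sub>R norm p) = of_real (norm p)"
      using False by (simp add: cinner_simps cinner_self power2_eq_square)
    moreover have "norm (p /\<^sub>R norm p) = 1" using False by simp
    ultimately show ?thesis using wedge zg by metis
  qed
qed

text \<open>Split \<open>y\<close> into \<open>q *\<^sub>R x\<close> and a part \<open>h\<close>
  orthogonal to \<open>x\<close>, of norm \<open>sqrt (1 - q\<^sup>2)\<close>. Only the component of
  \<open>z\<close> orthogonal to \<open>x\<close> pairs with \<open>h\<close>, and Cauchy-Schwarz
  bounds that pairing by the left side of \<open>le\<close>.\<close>

lemma Re_cinner_nonneg_if_wedge_norm_le:
  assumes x: "norm x = 1" and y: "norm y = 1" and xy: "cinner x y = of_real q"
    and le: "sqrt (1 - q\<^sup>2) * wedge_norm z x \<le> q * Re (cinner z x)"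
  shows "0 \<le> Re (cinner z y)"
proof -
  define h where "h = y - q *\<^sub>R x"
  have xx: "cinner x x = 1" using x by (simp add: cinner_self)
  have xh: "cinner x h = 0" by (simp add: h_def cinner_simps xy xx)
  have yx: "cinner y x = of_real q"
    using cnj_cinner[of x y] xy by simp
  have "(norm h)\<^sup>2 = 1 - q\<^sup>2"
    using norm_sq_diff_proj[OF x, of y] by (simp add: h_def yx y scaleR_scaleC)
  then have h: "norm h = sqrt (1 - q\<^sup>2)"
    by (metis norm_ge_zero real_sqrt_unique)
  have "cinner z h = cinner (z - cinner z x *\<^sub>C x) h"
    by (simp add: cinner_simps xh)
  then have "cmod (cinner z h) \<le> wedge_norm z x * sqrt (1 - q\<^sup>2)"
    using cauchy_schwarz[of "z - cinner z x *\<^sub>C x" h] by (simp add: h wedge_norm_unit[OF x])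
  moreover have "- Re (cinner z h) \<le> cmod (cinner z h)"
    using abs_Re_le_cmod[of "cinner z h"] by linarith
  moreover have "Re (cinner z y) = q * Re (cinner z x) + Re (cinner z h)"
    by (simp add: h_def cinner_simps)
  ultimately show ?thesis using le by (simp add: mult.commute)
qed

section \<open>The power inequality for the q-numerical radius\<close>

text \<open>The operator norm bounds the set of values, so its \<open>Sup\<close> is a genuine upper
  bound; the pair at hand shows that the set is nonempty.\<close>

lemma cmod_cinner_le_q_numerical_radius:
  assumes "bounded_linear A" and "norm x = 1" "norm y = 1" "cinner x y = q"
  shows "cmod (cinner (A x) y) \<le> q_numerical_radius q A"
proof -
  let ?V = "{cmod (cinner (A x) y) | x y. norm x = 1 \<and> norm y = 1 \<and> cinner x y = q}"
  have mem: "cmod (cinner (A x) y) \<in> ?V" using assms by blast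
  have "bdd_above ?V"
  proof (rule bdd_aboveI)
    fix r assume "r \<in> ?V"
    then obtain x y where r: "r = cmod (cinner (A x) y)" and xy: "norm x = 1" "norm y = 1"
      by blast
    have "r \<le> norm (A x)" using cauchy_schwarz[of "A x" y] r xy by simp
    also have "\<dots> \<le> onorm A" using onorm[OF assms(1), of x] xy by simp
    finally show "r \<le> onorm A" .
  qed
  then have "cmod (cinner (A x) y) \<le> Sup ?V" by (rule cSup_upper[OF mem])
  moreover have "?V \<noteq> {}" using mem by blast
  ultimately show ?thesis unfolding q_numerical_radius_def Let_def by (simp only: if_False)
qed

text \<open>The condition \<open>0 \<le> B\<close> covers the case of no admissible pairs, where the
  radius is 0 by definition.\<close>

lemma q_numerical_radius_le:
  assumes "\<And>x y. norm x = 1 \<Longrightarrow> norm y = 1 \<Longrightarrow> cinner x y = q \<Longrightarrow> cmod (cinner (A x) y) \<le> B"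
    and "0 \<le> B"
  shows "q_numerical_radius q A \<le> B"
proof -
  let ?V = "{cmod (cinner (A x) y) | x y. norm x = 1 \<and> norm y = 1 \<and> cinner x y = q}"
  have "Sup ?V \<le> B" if "?V \<noteq> {}"
    using assms(1) by (intro cSup_least[OF that]) blast
  then show ?thesis
    unfolding q_numerical_radius_def Let_def using assms(2) by (simp only: split: if_split) blast
qed

lemma bounded_clinear_scaleC:
  assumes "bounded_clinear A"
  shows "bounded_clinear (\<lambda>x. c *\<^sub>C A x)"
proof -
  have A: "bounded_linear A" and hom: "\<And>c x. A (c *\<^sub>C x) = c *\<^sub>C A x"
    using assms by (auto simp: bounded_clinear_def)
  have "norm (c *\<^sub>C A x) \<le> norm x * (cmod c * onorm A)" for x
    using mult_left_mono[OF onorm[OF A, of x] norm_ge_zero[of c]] by (simp add: norm_scaleC mult_ac)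
  then have "bounded_linear (\<lambda>x. c *\<^sub>C A x)"
    by (intro bounded_linear_intro[where K = "cmod c * onorm A"])
      (simp_all add: linear_simps[OF A] scaleC_add_right scaleR_scaleC scaleC_scaleC hom mult.commute)
  then show ?thesis
    by (simp add: bounded_clinear_def hom scaleC_scaleC mult.commute)
qed

text \<open>For a unit vector \<open>e\<close>, test the radius on the admissible partner
  \<open>y\<close> of \<open>e\<close> that minimizes the real part of \<open>cinner z y\<close>,
  where \<open>z = M *\<^sub>R e - A e\<close>. The bound \<open>q * M\<close> forces this minimum
  to be nonnegative, which is the claim for \<open>e\<close>.\<close>

lemma wedge_norm_resolvent_le:
  fixes A :: "'a::complex_inner_space \<Rightarrow> 'a"
  assumes A: "bounded_linear A"
    and orth: "\<exists>g. norm g = 1 \<and> cinner u g = 0"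
    and q: "0 < q" "q \<le> 1" and M: "q_numerical_radius (of_real q) A \<le> q * M"
  shows "sqrt (1 - q\<^sup>2) * wedge_norm (M *\<^sub>R u - A u) u \<le> q * Re (cinner (M *\<^sub>R u - A u) u)"
proof (cases "u = 0")
  case True
  then show ?thesis by (simp add: wedge_norm_def)
next
  case False
  define e where "e = u /\<^sub>R norm u"
  define z where "z = M *\<^sub>R e - A e"
  define s where "s = sqrt (1 - q\<^sup>2)"
  have s2: "s\<^sup>2 = 1 - q\<^sup>2" using q by (simp add: s_def power_le_one)
  have e: "norm e = 1" and u: "u = norm u *\<^sub>R e"
    using False by (simp_all add: e_def)
  have ee: "cinner e e = 1" using e by (simp add: cinner_self)
  have "\<exists>g. norm g = 1 \<and> cinner e g = 0"
    using orth by (simp add: e_def cinner_simps) blast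
  then obtain g where g: "norm g = 1" "cinner e g = 0" "cinner z g = of_real (wedge_norm z e)"
    using wedge_norm_attained[OF _ e] by blast
  \<comment> \<open>As \<open>g\<close> is aligned with the part of \<open>z\<close> orthogonal to
    \<open>e\<close>, the minus sign makes \<open>g\<close> contribute
    \<open>- s * wedge_norm z e\<close> to \<open>cinner z y\<close>.\<close>
  define y where "y = q *\<^sub>R e - s *\<^sub>R g"
  have ey: "cinner e y = of_real q"
    by (simp add: y_def cinner_simps ee g)
  have "(norm y)\<^sup>2 = 1"
    using norm_add_sq[of "q *\<^sub>R e" "- (s *\<^sub>R g)"]
    by (simp add: y_def e g cinner_simps power_mult_distrib s2)
  then have y: "norm y = 1"
    using norm_ge_zero[of y] by (auto simp: power2_eq_1_iff)
  have "Re (cinner (A e) y) \<le> q * M"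
    using cmod_cinner_le_q_numerical_radius[OF A e y ey] M complex_Re_le_cmod[of "cinner (A e) y"]
    by linarith
  moreover have "cinner (A e) y = of_real (q * M) - cinner z y"
    by (simp add: z_def cinner_simps ey)
  moreover have "cinner z y = of_real q * cinner z e - of_real (s * wedge_norm z e)"
    by (simp add: y_def cinner_simps g)
  ultimately have le: "s * wedge_norm z e \<le> q * Re (cinner z e)"
    by simp
  \<comment> \<open>From \<open>e\<close> back to \<open>u\<close>: both sides of the inequality
    scale by the square of \<open>norm u\<close>.\<close>
  have "A u = norm u *\<^sub>R A e"
    by (subst u) (simp add: linear_simps[OF A])
  then have zu: "M *\<^sub>R u - A u = norm u *\<^sub>R z"
    by (subst u) (simp add: z_def algebra_simps)
  have "wedge_norm (norm u *\<^sub>R z) u = norm u * wedge_norm u z"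
    by (subst wedge_norm_commute) (simp add: wedge_norm_scaleR)
  also have "wedge_norm u z = norm u * wedge_norm z e"
    by (subst wedge_norm_commute, subst u, subst wedge_norm_scaleR) simp
  finally have wedge: "wedge_norm (norm u *\<^sub>R z) u = (norm u)\<^sup>2 * wedge_norm z e"
    by (simp add: power2_eq_square)
  have "cinner (norm u *\<^sub>R z) u = of_real ((norm u)\<^sup>2) * cinner z e"
    by (subst (2) u) (simp add: cinner_simps power2_eq_square)
  then have "Re (cinner (norm u *\<^sub>R z) u) = (norm u)\<^sup>2 * Re (cinner z e)"
    by (simp del: of_real_power)
  moreover have "(norm u)\<^sup>2 * (s * wedge_norm z e) \<le> (norm u)\<^sup>2 * (q * Re (cinner z e))"
    using le by (rule mult_left_mono) simp
  ultimately show ?thesis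
    unfolding zu wedge s_def[symmetric] by (simp add: mult_ac)
qed

lemma Re_cinner_square_le:
  fixes A :: "'a::complex_inner_space \<Rightarrow> 'a"
  assumes A: "bounded_linear A"
    and orth: "\<And>u::'a. \<exists>g. norm g = 1 \<and> cinner u g = 0"
    and q: "0 < q" "q \<le> 1" and M: "q_numerical_radius (of_real q) A \<le> q * M" "0 < M"
    and xy: "norm x = 1" "norm y = 1" "cinner x y = of_real q"
  shows "Re (cinner (A (A x)) y) \<le> q * M\<^sup>2"
proof -
  \<comment> \<open>The factorizations (M - A)(M + A) = (M + A)(M - A) = M^2 - A^2 write the same
    \<open>z\<close> as M - A applied to \<open>u\<close> and as M + A applied to
    \<open>v\<close>.\<close>
  define u where "u = M *\<^sub>R x + A x"
  define v where "v = M *\<^sub>R x - A x"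
  define z where "z = M\<^sup>2 *\<^sub>R x - A (A x)"
  define s where "s = sqrt (1 - q\<^sup>2)"
  have s: "0 \<le> s" using q by (simp add: s_def power_le_one)
  have neg: "bounded_linear (\<lambda>x. - A x)" by (rule bounded_linear_minus[OF A])
  have "q_numerical_radius (of_real q) (\<lambda>x. - A x) = q_numerical_radius (of_real q) A"
    by (simp add: q_numerical_radius_def cinner_minus_left)
  with M have M': "q_numerical_radius (of_real q) (\<lambda>x. - A x) \<le> q * M" by simp
  have zu: "M *\<^sub>R u - A u = z" and zv: "M *\<^sub>R v - (- A v) = z"
    by (simp_all add: u_def v_def z_def linear_simps[OF A] algebra_simps power2_eq_square)
  have uv: "u + v = (2 * M) *\<^sub>R x" by (simp add: u_def v_def scaleR_2 flip: scaleR_scaleR)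
  have "s * wedge_norm z (u + v) \<le> s * wedge_norm z u + s * wedge_norm z v"
    using mult_left_mono[OF wedge_norm_triangle[of z u v] s] by (simp add: distrib_left)
  also have "\<dots> \<le> q * Re (cinner z u) + q * Re (cinner z v)"
    using wedge_norm_resolvent_le[OF A orth q M(1), of u]
      wedge_norm_resolvent_le[OF neg orth q M', of v]
    unfolding zu zv s_def by (rule add_mono)
  also have "\<dots> = q * Re (cinner z (u + v))"
    by (simp add: cinner_add_right distrib_left)
  finally have "2 * M * (s * wedge_norm z x) \<le> 2 * M * (q * Re (cinner z x))"
    using M(2) by (simp add: uv wedge_norm_scaleR cinner_scaleR_right mult_ac)
  \<comment> \<open>Positivity of \<open>M\<close> permits cancelling \<open>2 * M\<close>.\<close>
  then have "s * wedge_norm z x \<le> q * Re (cinner z x)"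
    using M(2) by (simp only: mult_le_cancel_left_pos mult_pos_pos zero_less_numeral)
  then have "0 \<le> Re (cinner z y)"
    unfolding s_def by (rule Re_cinner_nonneg_if_wedge_norm_le[OF xy])
  moreover have "cinner z y = of_real (M\<^sup>2 * q) - cinner (A (A x)) y"
    by (simp add: z_def cinner_simps xy)
  ultimately show ?thesis by (simp add: mult.commute del: of_real_mult of_real_power)
qed

text \<open>Multiplying \<open>A\<close> by a phase \<open>c\<close> multiplies its square by
  \<open>c\<^sup>2\<close>, so the bound on a real part becomes a bound on the modulus. The natural
  choice M = W / q may be zero; it is reached as a limit from above.\<close>

theorem q_numerical_radius_power_inequality:
  fixes A :: "'a::complex_inner_space \<Rightarrow> 'a"
  assumes A: "bounded_clinear A"
    and orth: "\<And>u::'a. \<exists>g. norm g = 1 \<and> cinner u g = 0"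
    and q: "0 < q" "q \<le> 1"
    and xy: "norm x = 1" "norm y = 1" "cinner x y = of_real q"
  shows "q * cmod (cinner (A (A x)) y) \<le> (q_numerical_radius (of_real q) A)\<^sup>2"
proof -
  define W where "W = q_numerical_radius (of_real q) A"
  have hom: "\<And>c x. A (c *\<^sub>C x) = c *\<^sub>C A x" and bl: "bounded_linear A"
    using A by (auto simp: bounded_clinear_def)
  define t where "t = cinner (A (A x)) y"
  \<comment> \<open>Chosen so that \<open>c\<^sup>2 * t\<close> is the modulus of \<open>t\<close>.
    If \<open>t = 0\<close> then \<open>sgn t = 0\<close> and \<open>c = 0\<close>, hence only
    \<open>cmod c \<le> 1\<close> is claimed.\<close>
  define c where "c = csqrt (cnj (sgn t))"
  have cc: "c\<^sup>2 = cnj (sgn t)" by (simp add: c_def)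
  have "cmod c \<le> 1"
  proof -
    have "(cmod c)\<^sup>2 \<le> 1\<^sup>2" by (simp add: norm_power[symmetric] cc norm_sgn)
    then show ?thesis by (rule power2_le_imp_le) simp
  qed
  have ct: "c\<^sup>2 * t = of_real (cmod t)"
    using mult_cnj_eq[of t] unfolding cc
    by (cases "t = 0") (simp_all add: sgn_eq divide_eq_eq power2_eq_square mult.commute)
  define B where "B = (\<lambda>x. c *\<^sub>C A x)"
  have B: "bounded_linear B"
    using bounded_clinear_scaleC[OF A] by (simp add: B_def bounded_clinear_def)
  have W0: "0 \<le> W"
    unfolding W_def using norm_ge_zero cmod_cinner_le_q_numerical_radius[OF bl xy]
    by (rule order_trans)
  have BW: "q_numerical_radius (of_real q) B \<le> W"
  proof (rule q_numerical_radius_le[OF _ W0])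
    fix x y :: 'a assume xy: "norm x = 1" "norm y = 1" "cinner x y = of_real q"
    have "cmod (cinner (B x) y) \<le> cmod (cinner (A x) y)"
      using \<open>cmod c \<le> 1\<close> by (simp add: B_def cinner_scaleC_left norm_mult mult_left_le_one_le)
    also have "\<dots> \<le> W"
      unfolding W_def by (rule cmod_cinner_le_q_numerical_radius[OF bl xy])
    finally show "cmod (cinner (B x) y) \<le> W" .
  qed
  have "cinner (B (B x)) y = c\<^sup>2 * t"
    by (simp add: B_def hom cinner_scaleC_left t_def power2_eq_square mult.assoc)
  then have BB: "Re (cinner (B (B x)) y) = cmod t" by (simp add: ct)
  \<comment> \<open>Any \<open>K\<close> above \<open>W\<close> is positive, so
    \<open>M = K / q\<close> is admissible in the bound for real parts; the extra factor
    \<open>q\<close> turns q^2 (K / q)^2 into K^2.\<close>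
  have le: "q * cmod t \<le> K\<^sup>2" if "W < K" for K
  proof -
    have "Re (cinner (B (B x)) y) \<le> q * (K / q)\<^sup>2"
      by (rule Re_cinner_square_le[OF B orth q _ _ xy]) (use that BW W0 q in auto)
    then have "q * cmod t \<le> q * (q * (K / q)\<^sup>2)"
      using q by (simp add: BB mult_left_mono)
    then show ?thesis using q by (simp add: power2_eq_square)
  qed
  \<comment> \<open>Let \<open>K\<close> decrease to \<open>W\<close>.\<close>
  have "((\<lambda>K. K\<^sup>2) \<longlongrightarrow> W\<^sup>2) (at_right W)"
    by (intro tendsto_intros)
  moreover have "eventually (\<lambda>K. q * cmod t \<le> K\<^sup>2) (at_right W)"
    using le by (auto simp: eventually_at_filter)
  ultimately have "q * cmod t \<le> W\<^sup>2"
    by (intro tendsto_lowerbound[of _ _ "at_right W"]) auto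
  then show ?thesis by (simp add: W_def t_def)
qed

section \<open>Off-diagonal operator matrices\<close>

text \<open>A nonzero summand makes the direct sum at least two-dimensional. If a component of
  \<open>u\<close> vanishes, put \<open>e\<close> into that slot. Otherwise rescale the two
  components with opposite signs so that their contributions cancel.\<close>

lemma exists_orthogonal_prod:
  fixes u :: "'a::complex_inner_space \<times> 'a" and e :: 'a
  assumes "e \<noteq> 0"
  shows "\<exists>g. norm g = 1 \<and> cinner u g = 0"
proof -
  obtain a b where u: "u = (a, b)" by (cases u)
  have "\<exists>g. g \<noteq> 0 \<and> cinner u g = 0"
  proof (cases "a = 0 \<or> b = 0")
    case True
    have "cinner u (e, 0) = 0 \<or> cinner u (0, e) = 0"
      using True by (auto simp: u cinner_prod_def)
    moreover have "(e, 0) \<noteq> (0 :: 'a \<times> 'a)" "(0, e) \<noteq> (0 :: 'a \<times> 'a)"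
      using assms by (auto simp: zero_prod_def)
    ultimately show ?thesis by blast
  next
    case False
    let ?g = "((norm b)\<^sup>2 *\<^sub>R a, - ((norm a)\<^sup>2 *\<^sub>R b))"
    have "cinner u ?g = 0"
      by (simp add: u cinner_prod_def cinner_simps cinner_self mult.commute)
    moreover have "?g \<noteq> 0" using False by (auto simp: zero_prod_def)
    ultimately show ?thesis by blast
  qed
  then obtain g where "g \<noteq> 0" "cinner u g = 0" by blast
  then have "norm (g /\<^sub>R norm g) = 1 \<and> cinner u (g /\<^sub>R norm g) = 0"
    by (simp add: cinner_simps)
  then show ?thesis by blast
qed

lemma bounded_clinear_off_diagonal:
  assumes "bounded_clinear T2" "bounded_clinear T3"
  shows "bounded_clinear (block_operator (\<lambda>_. 0) T2 T3 (\<lambda>_. 0))"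
proof -
  have 2: "bounded_linear T2" "\<And>c x. T2 (c *\<^sub>C x) = c *\<^sub>C T2 x"
    and 3: "bounded_linear T3" "\<And>c x. T3 (c *\<^sub>C x) = c *\<^sub>C T3 x"
    using assms by (auto simp: bounded_clinear_def)
  have "bounded_linear (\<lambda>z. (T2 (snd z), T3 (fst z)))"
    by (intro bounded_linear_Pair bounded_linear_compose[OF 2(1)] bounded_linear_compose[OF 3(1)]
        bounded_linear_fst bounded_linear_snd)
  then show ?thesis
    by (simp add: bounded_clinear_def block_operator_def case_prod_unfold scaleC_prod_def 2 3)
qed

theorem theorem2p12:
  fixes T2 T3 :: "'h::complex_hilbert_space \<Rightarrow> 'h" and q :: real
  assumes "bounded_clinear T2" and "bounded_clinear T3"
    and "0 < q" and "q \<le> 1"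
    and dim_ge_2: "q < 1 \<Longrightarrow> \<exists>B :: 'h set. complex_vector.independent B \<and> card B = 2"
  shows "(q_numerical_radius (complex_of_real q) (block_operator (\<lambda>_. 0) T2 T3 (\<lambda>_. 0)))\<^sup>2
    \<ge> q / 2 * max (q_numerical_radius (complex_of_real q) (\<lambda>x. T2 (T3 x) + T3 (T2 x)))
                  (q_numerical_radius (complex_of_real q) (\<lambda>x. T2 (T3 x) - T3 (T2 x)))"
proof -
  define T where "T = block_operator (\<lambda>_. 0) T2 T3 (\<lambda>_. 0)"
  define W where "W = q_numerical_radius (complex_of_real q) T"
  have T: "bounded_clinear T"
    unfolding T_def using assms(1,2) by (rule bounded_clinear_off_diagonal)
  \<comment> \<open>Placing \<open>x\<close> and \<open>y\<close> in the same summand preserves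
    norms and inner products, so admissible pairs stay admissible. The square of \<open>T\<close>
    acts as T2 T3 on the first summand and as T3 T2 on the second.\<close>
  have products: "q * cmod (cinner (T2 (T3 x)) y) \<le> W\<^sup>2" "q * cmod (cinner (T3 (T2 x)) y) \<le> W\<^sup>2"
    if xy: "norm x = 1" "norm y = 1" "cinner x y = of_real q" for x y
  proof -
    have "x \<noteq> 0" using xy by auto
    note power = q_numerical_radius_power_inequality[OF T exists_orthogonal_prod[OF this] assms(3,4),
        folded W_def]
    have lin: "T2 0 = 0" "T3 0 = 0"
      using assms(1,2) by (auto simp: bounded_clinear_def linear_simps)
    show "q * cmod (cinner (T2 (T3 x)) y) \<le> W\<^sup>2"
      using power[of "(x, 0)" "(y, 0)"]
      by (simp add: T_def block_operator_def cinner_prod_def norm_Pair xy lin)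
    show "q * cmod (cinner (T3 (T2 x)) y) \<le> W\<^sup>2"
      using power[of "(0, x)" "(0, y)"]
      by (simp add: T_def block_operator_def cinner_prod_def norm_Pair xy lin)
  qed
  \<comment> \<open>This one bound serves both signs, by the triangle inequality for the sum and for
    the difference.\<close>
  have sum: "cmod (cinner (T2 (T3 x)) y) + cmod (cinner (T3 (T2 x)) y) \<le> 2 * W\<^sup>2 / q"
    if xy: "norm x = 1" "norm y = 1" "cinner x y = of_real q" for x y
    using products[OF xy] assms(3) by (simp add: field_simps)
  have "q_numerical_radius (of_real q) (\<lambda>x. T2 (T3 x) + T3 (T2 x)) \<le> 2 * W\<^sup>2 / q"
  proof (rule q_numerical_radius_le)
    fix x y :: 'h assume xy: "norm x = 1" "norm y = 1" "cinner x y = of_real q"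
    show "cmod (cinner (T2 (T3 x) + T3 (T2 x)) y) \<le> 2 * W\<^sup>2 / q"
      unfolding cinner_add_left using norm_triangle_ineq sum[OF xy] by (rule order_trans)
  qed (use assms(3) in simp)
  moreover have "q_numerical_radius (of_real q) (\<lambda>x. T2 (T3 x) - T3 (T2 x)) \<le> 2 * W\<^sup>2 / q"
  proof (rule q_numerical_radius_le)
    fix x y :: 'h assume xy: "norm x = 1" "norm y = 1" "cinner x y = of_real q"
    show "cmod (cinner (T2 (T3 x) - T3 (T2 x)) y) \<le> 2 * W\<^sup>2 / q"
      unfolding cinner_diff_left using norm_triangle_ineq4 sum[OF xy] by (rule order_trans)
  qed (use assms(3) in simp)
  ultimately have "q / 2 * max (q_numerical_radius (of_real q) (\<lambda>x. T2 (T3 x) + T3 (T2 x)))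
      (q_numerical_radius (of_real q) (\<lambda>x. T2 (T3 x) - T3 (T2 x))) \<le> q / 2 * (2 * W\<^sup>2 / q)"
    using assms(3) by (intro mult_left_mono) auto
  also have "\<dots> = W\<^sup>2" using assms(3) by simp
  finally show ?thesis by (simp add: W_def T_def)
qed

end
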